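(* Let $\mathbf{x}:U\to\mathbb{R}^3$ be a proper wavefront all of whose singularities have rank 1 (i.e. $\mathrm{rank}(D\mathbf{x}(\mathbf{q}))=1$ for every $\mathbf{q}\in\Sigma(\mathbf{x})$), let $\Omega$ be a tangent moving basis of $\mathbf{x}$, and let $\mathbf{p}\in\Sigma(\mathbf{x})$. Let $W\subset U$ be a compact neighborhood of $\mathbf{p}$ on which the relative principal curvature $k_{i\Omega}$ ($i\in\{1,2\}$) does not vanish. Let $k_j$ ($\{i,j\}=\{1,2\}$) be the function that admits a $C^\infty$ extension to $W$ (the extension is again denoted $k_j$), and let $K$ be the Gaussian curvature of $\mathbf{x}$. Then the following statements are equivalent: (1) $K$ is bounded on $W\setminus\Sigma(\mathbf{x})$. (2) There exists a constant $C>0$ such that $|K_\Omega|\le C|\lambda_\Omega|$ on $W$. (3) There exists a constant $C>0$ such that $|k_j|\le C|\lambda_\Omega|$ on $W$. (4) There exists a constant $C>0$ such that $|e|\le C|\lambda_\Omega|$, $|f|\le C|\lambda_\Omega|$ and $|g|\le C|\lambda_\Omega|$ on $W$.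
   Context: All maps are $C^\infty$; $U\subset\mathbb{R}^2$ is open, with coordinates $(u,v)$. A smooth map $\mathbf{x}:U\to\mathbb{R}^3$ is a frontal if every $\mathbf{p}\in U$ has an open neighborhood $V_p\subset U$ with a smooth unit vector field $\mathbf{n}_p:V_p\to\mathbb{R}^3$ orthogonal to $\mathbf{x}_u,\mathbf{x}_v$; it is a wavefront (front) if moreover each $(\mathbf{x},\mathbf{n}_p)$ is an immersion into $\mathbb{R}^3\times S^2$. The singular set is $\Sigma(\mathbf{x})=\{\mathbf{p}\in U:\mathbf{x}\text{ is not immersive at }\mathbf{p}\}$; $\mathbf{x}$ is proper if $\Sigma(\mathbf{x})$ has empty interior. A tangent moving basis (tmb) of $\mathbf{x}$ is a smooth map $\Omega=(\mathbf{w}_1\ \mathbf{w}_2):U\to\mathcal{M}_{3\times2}(\mathbb{R})$ with linearly independent columns at each point and $\mathbf{x}_u,\mathbf{x}_v\in\mathrm{span}(\mathbf{w}_1,\mathbf{w}_2)$. Put $\mathbf{n}=\frac{\mathbf{w}_1\times\mathbf{w}_2}{\|\mathbf{w}_1\times\mathbf{w}_2\|}$, $\mathbf{I}_\Omega=\Omega^T\Omega$, $\mathbf{II}_\Omega=-\Omega^TD\mathbf{n}$, $\mu_\Omega=-\mathbf{II}_\Omega^T\mathbf{I}_\Omega^{-1}$, $\Lambda_\Omega=D\mathbf{x}^T\Omega\,\mathbf{I}_\Omega^{-1}$, $\lambda_\Omega=\det\Lambda_\Omega$, $K_\Omega=\det\mu_\Omega$, $H_\Omega=-\frac12\mathrm{tr}(\mu_\Omega\,\mathrm{adj}(\Lambda_\Omega))$.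 One has $D\mathbf{x}=\Omega\Lambda_\Omega^T$ and $D\mathbf{n}=\Omega\mu_\Omega^T$, so $\Sigma(\mathbf{x})=\lambda_\Omega^{-1}(0)$. The fundamental forms are $\begin{pmatrix} E & F \\ F & G \end{pmatrix}=D\mathbf{x}^TD\mathbf{x}$ and $\begin{pmatrix} e & f \\ f & g \end{pmatrix}=-D\mathbf{x}^TD\mathbf{n}$ on $U$; on $U\setminus\Sigma(\mathbf{x})$, $K=\frac{eg-f^2}{EG-F^2}$ and $H=\frac{eG+gE-2fF}{2(EG-F^2)}$ are the Gaussian and mean curvatures. The relative principal curvatures are $k_{1\Omega}=H_\Omega-\sqrt{H_\Omega^2-\lambda_\Omega K_\Omega}$ and $k_{2\Omega}=H_\Omega+\sqrt{H_\Omega^2-\lambda_\Omega K_\Omega}$ on $U$. On $U\setminus\Sigma(\mathbf{x})$: $k_1=H-\sqrt{H^2-K}$ and $k_2=H+\sqrt{H^2-K}$ where $\lambda_\Omega>0$; $k_1=H+\sqrt{H^2-K}$ and $k_2=H-\sqrt{H^2-K}$ where $\lambda_\Omega<0$. Where $k_{i\Omega}\neq0$, one has $k_j=K_\Omega/k_{i\Omega}$ off $\Sigma(\mathbf{x})$, and the quotient $K_\Omega/k_{i\Omega}$ provides the extension of $k_j$ across $\Sigma(\mathbf{x})$.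
   Formalization: The formal theorem also assumes that W∖Σ(x) is dense in W (automatic if W is the closure of its interior); without this, W may contain a thin piece of Σ(x) far from p on which K_Ω ≠ 0 = λ_Ω, so that (1) holds and (2) fails. *)

theory Defs
  imports "HOL-Analysis.Analysis"
begin

section \<open>Smooth maps\<close>

text \<open>Only meant for open \<open>S\<close>: all iterated directional derivatives of order at most
  \<open>k\<close> exist and are continuous.\<close>

primrec C_k_on :: "nat \<Rightarrow> ('a::euclidean_space) set \<Rightarrow> ('a \<Rightarrow> 'b::real_normed_vector) \<Rightarrow> bool" where
  "C_k_on 0 S f \<longleftrightarrow> continuous_on S f"
| "C_k_on (Suc k) S f \<longleftrightarrow>
     (\<forall>p\<in>S. f differentiable (at p)) \<and> (\<forall>v. C_k_on k S (\<lambda>p. frechet_derivative f (at p) v))"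

definition smooth_on :: "('a::euclidean_space) set \<Rightarrow> ('a \<Rightarrow> 'b::real_normed_vector) \<Rightarrow> bool" where
  "smooth_on S f \<longleftrightarrow> (\<forall>k. C_k_on k S f)"

definition immersive_at :: "('a::euclidean_space \<Rightarrow> 'b::real_normed_vector) \<Rightarrow> 'a \<Rightarrow> bool" where
  "immersive_at f p \<longleftrightarrow> f differentiable (at p) \<and> inj (frechet_derivative f (at p))"

section \<open>Fronts in three-space\<close>

abbreviation D :: "(real^2 \<Rightarrow> real^3) \<Rightarrow> real^2 \<Rightarrow> real^2^3" where
  "D f p \<equiv> jacobian f (at p)"

abbreviation partial_u :: "(real^2 \<Rightarrow> real^3) \<Rightarrow> real^2 \<Rightarrow> real^3" where
  "partial_u f p \<equiv> frechet_derivative f (at p) (axis 1 1)"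

abbreviation partial_v :: "(real^2 \<Rightarrow> real^3) \<Rightarrow> real^2 \<Rightarrow> real^3" where
  "partial_v f p \<equiv> frechet_derivative f (at p) (axis 2 1)"

definition unit_normal_on :: "(real^2) set \<Rightarrow> (real^2 \<Rightarrow> real^3) \<Rightarrow> (real^2 \<Rightarrow> real^3) \<Rightarrow> bool" where
  "unit_normal_on V x n \<longleftrightarrow> smooth_on V n \<and>
     (\<forall>q\<in>V. norm (n q) = 1 \<and> orthogonal (n q) (partial_u x q) \<and> orthogonal (n q) (partial_v x q))"

text \<open>As \<open>n\<close> has unit length, \<open>(x, n)\<close> is an immersion into the product of three-space with the
  unit sphere iff it is an immersion into the ambient product of vector spaces.\<close>

definition wavefront :: "(real^2) set \<Rightarrow> (real^2 \<Rightarrow> real^3) \<Rightarrow> bool" where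
  "wavefront U x \<longleftrightarrow> smooth_on U x \<and>
     (\<forall>p\<in>U. \<exists>V n. open V \<and> p \<in> V \<and> V \<subseteq> U \<and> unit_normal_on V x n \<and>
        (\<forall>q\<in>V. immersive_at (\<lambda>r. (x r, n r)) q))"

definition singular_set :: "(real^2) set \<Rightarrow> (real^2 \<Rightarrow> real^3) \<Rightarrow> (real^2) set" where
  "singular_set U x = {p \<in> U. \<not> immersive_at x p}"

definition proper_frontal :: "(real^2) set \<Rightarrow> (real^2 \<Rightarrow> real^3) \<Rightarrow> bool" where
  "proper_frontal U x \<longleftrightarrow> interior (singular_set U x) = {}"

section \<open>Tangent moving bases and relative curvatures\<close>

definition tangent_moving_basis ::
    "(real^2) set \<Rightarrow> (real^2 \<Rightarrow> real^3) \<Rightarrow> (real^2 \<Rightarrow> real^2^3) \<Rightarrow> bool" where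
  "tangent_moving_basis U x \<Omega> \<longleftrightarrow> smooth_on U \<Omega> \<and>
     (\<forall>q\<in>U. let w1 = column 1 (\<Omega> q); w2 = column 2 (\<Omega> q) in
        w1 \<noteq> w2 \<and> independent {w1, w2} \<and>
        partial_u x q \<in> span {w1, w2} \<and> partial_v x q \<in> span {w1, w2})"

definition tmb_normal :: "(real^2 \<Rightarrow> real^2^3) \<Rightarrow> real^2 \<Rightarrow> real^3" where
  "tmb_normal \<Omega> q =
     (let c = cross3 (column 1 (\<Omega> q)) (column 2 (\<Omega> q)) in (1 / norm c) *\<^sub>R c)"

definition I_rel :: "(real^2 \<Rightarrow> real^2^3) \<Rightarrow> real^2 \<Rightarrow> real^2^2" where
  "I_rel \<Omega> q = transpose (\<Omega> q) ** \<Omega> q"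

definition II_rel :: "(real^2 \<Rightarrow> real^2^3) \<Rightarrow> real^2 \<Rightarrow> real^2^2" where
  "II_rel \<Omega> q = - (transpose (\<Omega> q) ** D (tmb_normal \<Omega>) q)"

definition mu_rel :: "(real^2 \<Rightarrow> real^2^3) \<Rightarrow> real^2 \<Rightarrow> real^2^2" where
  "mu_rel \<Omega> q = - (transpose (II_rel \<Omega> q) ** matrix_inv (I_rel \<Omega> q))"

definition Lambda_rel :: "(real^2 \<Rightarrow> real^3) \<Rightarrow> (real^2 \<Rightarrow> real^2^3) \<Rightarrow> real^2 \<Rightarrow> real^2^2" where
  "Lambda_rel x \<Omega> q = transpose (D x q) ** \<Omega> q ** matrix_inv (I_rel \<Omega> q)"

definition lambda_rel :: "(real^2 \<Rightarrow> real^3) \<Rightarrow> (real^2 \<Rightarrow> real^2^3) \<Rightarrow> real^2 \<Rightarrow> real" where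
  "lambda_rel x \<Omega> q = det (Lambda_rel x \<Omega> q)"

definition adj2 :: "real^2^2 \<Rightarrow> real^2^2" where
  "adj2 A = vector [vector [A$2$2, - A$1$2], vector [- A$2$1, A$1$1]]"

definition K_rel :: "(real^2 \<Rightarrow> real^2^3) \<Rightarrow> real^2 \<Rightarrow> real" where
  "K_rel \<Omega> q = det (mu_rel \<Omega> q)"

definition H_rel :: "(real^2 \<Rightarrow> real^3) \<Rightarrow> (real^2 \<Rightarrow> real^2^3) \<Rightarrow> real^2 \<Rightarrow> real" where
  "H_rel x \<Omega> q = - (1/2) * trace (mu_rel \<Omega> q ** adj2 (Lambda_rel x \<Omega> q))"

text \<open>The index of a (relative) principal curvature ranges over the two-element type \<open>2\<close>,
  whose elements are \<open>1\<close> and \<open>2\<close>.\<close>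

definition k_rel :: "(real^2 \<Rightarrow> real^3) \<Rightarrow> (real^2 \<Rightarrow> real^2^3) \<Rightarrow> 2 \<Rightarrow> real^2 \<Rightarrow> real" where
  "k_rel x \<Omega> i q =
     (let r = sqrt ((H_rel x \<Omega> q)\<^sup>2 - lambda_rel x \<Omega> q * K_rel \<Omega> q) in
      if i = 1 then H_rel x \<Omega> q - r else H_rel x \<Omega> q + r)"

section \<open>Classical curvatures\<close>

definition first_form :: "(real^2 \<Rightarrow> real^3) \<Rightarrow> real^2 \<Rightarrow> real^2^2" where
  "first_form x q = transpose (D x q) ** D x q"

definition second_form :: "(real^2 \<Rightarrow> real^3) \<Rightarrow> (real^2 \<Rightarrow> real^2^3) \<Rightarrow> real^2 \<Rightarrow> real^2^2" where
  "second_form x \<Omega> q = - (transpose (D x q) ** D (tmb_normal \<Omega>) q)"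

abbreviation "E_coeff x q \<equiv> first_form x q $ 1 $ 1"
abbreviation "F_coeff x q \<equiv> first_form x q $ 1 $ 2"
abbreviation "G_coeff x q \<equiv> first_form x q $ 2 $ 2"
abbreviation "e_coeff x \<Omega> q \<equiv> second_form x \<Omega> q $ 1 $ 1"
abbreviation "f_coeff x \<Omega> q \<equiv> second_form x \<Omega> q $ 1 $ 2"
abbreviation "g_coeff x \<Omega> q \<equiv> second_form x \<Omega> q $ 2 $ 2"

text \<open>The next three functions are meaningful only at regular points of \<open>x\<close>.\<close>

definition gauss_curv :: "(real^2 \<Rightarrow> real^3) \<Rightarrow> (real^2 \<Rightarrow> real^2^3) \<Rightarrow> real^2 \<Rightarrow> real" where
  "gauss_curv x \<Omega> q =
     (e_coeff x \<Omega> q * g_coeff x \<Omega> q - (f_coeff x \<Omega> q)\<^sup>2) /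
     (E_coeff x q * G_coeff x q - (F_coeff x q)\<^sup>2)"

definition mean_curv :: "(real^2 \<Rightarrow> real^3) \<Rightarrow> (real^2 \<Rightarrow> real^2^3) \<Rightarrow> real^2 \<Rightarrow> real" where
  "mean_curv x \<Omega> q =
     (e_coeff x \<Omega> q * G_coeff x q + g_coeff x \<Omega> q * E_coeff x q
        - 2 * f_coeff x \<Omega> q * F_coeff x q) /
     (2 * (E_coeff x q * G_coeff x q - (F_coeff x q)\<^sup>2))"

definition princ_curv :: "(real^2 \<Rightarrow> real^3) \<Rightarrow> (real^2 \<Rightarrow> real^2^3) \<Rightarrow> 2 \<Rightarrow> real^2 \<Rightarrow> real" where
  "princ_curv x \<Omega> j q =
     (let H = mean_curv x \<Omega> q; r = sqrt (H\<^sup>2 - gauss_curv x \<Omega> q) in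
      if lambda_rel x \<Omega> q > 0 then (if j = 1 then H - r else H + r)
      else (if j = 1 then H + r else H - r))"

text \<open>The principal curvature \<open>k\<^sub>j\<close>, extended across the singular set by \<open>K\<^sub>\<Omega> / k\<^sub>i\<^sub>\<Omega>\<close>;
  used only with \<open>i \<noteq> j\<close> and where \<open>k\<^sub>i\<^sub>\<Omega>\<close> does not vanish. There the quotient is continuous and
  coincides with \<open>k\<^sub>j\<close> at all regular points, so it is the only possible continuous (a fortiori
  smooth) extension wherever singular points are limits of regular ones.\<close>

definition princ_curv_ext ::
    "(real^2) set \<Rightarrow> (real^2 \<Rightarrow> real^3) \<Rightarrow> (real^2 \<Rightarrow> real^2^3) \<Rightarrow> 2 \<Rightarrow> 2 \<Rightarrow> real^2 \<Rightarrow> real" where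
  "princ_curv_ext U x \<Omega> i j q =
     (if q \<in> singular_set U x then K_rel \<Omega> q / k_rel x \<Omega> i q else princ_curv x \<Omega> j q)"

end

theory Submission
  imports Defs
begin

text \<open>
  Write \<open>L\<close>, \<open>M\<close>, \<open>I\<close> for \<open>\<Lambda>\<^sub>\<Omega>\<close>, \<open>\<mu>\<^sub>\<Omega>\<close>, \<open>I\<^sub>\<Omega>\<close>, and \<open>\<lambda>\<close>, \<open>K\<close>, \<open>H\<close>, \<open>k\<^sub>i\<close> for the relative
  quantities. The fundamental forms are \<open>B = L I L\<^sup>T\<close> and \<open>S = - L I M\<^sup>T\<close>; as \<open>S\<close> is symmetric, the
  polarised Cayley-Hamilton identity \<open>M adj L + L adj M = tr (M adj L)\<close> gives
  \<open>2 H S = \<lambda> M I M\<^sup>T + K B\<close>. With \<open>k\<^sub>i\<^sup>2 - 2 H k\<^sub>i + \<lambda> K = 0\<close> this becomes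
  \<open>k\<^sub>i\<^sup>2 S = \<lambda> (k\<^sub>i M I M\<^sup>T) + K (k\<^sub>i B - \<lambda> S)\<close>, so on a compact set where \<open>k\<^sub>i\<close> does not vanish
  \<open>K = O(\<lambda>)\<close> implies \<open>S = O(\<lambda>)\<close>. Conversely \<open>det S = \<lambda> K det I\<close>, so \<open>S = O(\<lambda>)\<close> implies \<open>K = O(\<lambda>)\<close> at
  regular points, hence everywhere by density. The remaining equivalences hold because the
  Gaussian curvature is \<open>K / \<lambda>\<close> at regular points and \<open>k\<^sub>j\<close> extends as \<open>K / k\<^sub>i\<close>.
\<close>

section \<open>Symmetry of second derivatives\<close>

text \<open>The mean value theorem is applied twice: in \<open>s\<close> to the increment of
  \<open>f\<close> along \<open>h *\<^sub>R v\<close>, then in \<open>t\<close> to the derivative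
  along \<open>u\<close>. The second difference on the left does not change when \<open>u\<close>
  and \<open>v\<close> are swapped, which is what the symmetry of mixed derivatives rests
  on.\<close>

lemma second_difference_mean_value:
  fixes f :: "'a::real_normed_vector \<Rightarrow> real"
  assumes S: "\<And>s t. 0 \<le> s \<Longrightarrow> s \<le> h \<Longrightarrow> 0 \<le> t \<Longrightarrow> t \<le> h \<Longrightarrow> q + s *\<^sub>R u + t *\<^sub>R v \<in> S"
    and f: "\<And>p. p \<in> S \<Longrightarrow> (f has_derivative f' p) (at p)"
    and fu: "\<And>p. p \<in> S \<Longrightarrow> ((\<lambda>r. f' r u) has_derivative fu p) (at p)"
    and h: "0 < h"
  shows "\<exists>s t. 0 < s \<and> s < h \<and> 0 < t \<and> t < h \<and>
    f (q + h *\<^sub>R u + h *\<^sub>R v) - f (q + h *\<^sub>R u) - f (q + h *\<^sub>R v) + f q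
      = h * h * fu (q + s *\<^sub>R u + t *\<^sub>R v) v"
proof -
  have sc: "f' p (a *\<^sub>R w) = a * f' p w" if "p \<in> S" for p a w
    using linear_scale[OF has_derivative_linear[OF f[OF that]], of a w] by simp
  have scu: "fu p (a *\<^sub>R w) = a * fu p w" if "p \<in> S" for p a w
    using linear_scale[OF has_derivative_linear[OF fu[OF that]], of a w] by simp
  have path: "((\<lambda>s. f (q + s *\<^sub>R u + t *\<^sub>R v)) has_real_derivative f' (q + s *\<^sub>R u + t *\<^sub>R v) u) (at s)"
    if "0 \<le> s" "s \<le> h" "0 \<le> t" "t \<le> h" for s t
  proof -
    have "((\<lambda>s. q + s *\<^sub>R u + t *\<^sub>R v) has_derivative (\<lambda>d. d *\<^sub>R u)) (at s)"
      by (auto intro!: derivative_eq_intros)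
    from has_derivative_compose[OF this f[OF S[OF that]]]
    show ?thesis
      unfolding has_field_derivative_def
      by (rule back_subst[where P="\<lambda>g. (_ has_derivative g) _"])
        (auto simp: sc[OF S[OF that]] mult.commute)
  qed
  have pathu: "((\<lambda>t. f' (q + s *\<^sub>R u + t *\<^sub>R v) u) has_real_derivative fu (q + s *\<^sub>R u + t *\<^sub>R v) v) (at t)"
    if "0 \<le> s" "s \<le> h" "0 \<le> t" "t \<le> h" for s t
  proof -
    have "((\<lambda>t. q + s *\<^sub>R u + t *\<^sub>R v) has_derivative (\<lambda>d. d *\<^sub>R v)) (at t)"
      by (auto intro!: derivative_eq_intros)
    from has_derivative_compose[OF this fu[OF S[OF that]]]
    show ?thesis
      unfolding has_field_derivative_def
      by (rule back_subst[where P="\<lambda>g. (_ has_derivative g) _"])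
        (auto simp: scu[OF S[OF that]] mult.commute)
  qed
  \<comment> \<open>The term \<open>0 *\<^sub>R v\<close> is kept so that both summands are
    instances of \<open>path\<close>.\<close>
  let ?\<phi> = "\<lambda>s. f (q + s *\<^sub>R u + h *\<^sub>R v) - f (q + s *\<^sub>R u + 0 *\<^sub>R v)"
  have "(?\<phi> has_real_derivative
      f' (q + s *\<^sub>R u + h *\<^sub>R v) u - f' (q + s *\<^sub>R u + 0 *\<^sub>R v) u) (at s)"
    if "0 \<le> s" "s \<le> h" for s
    using that h by (intro DERIV_diff path) auto
  then obtain s where s: "0 < s" "s < h"
    and s_eq: "?\<phi> h - ?\<phi> 0 = (h - 0) * (f' (q + s *\<^sub>R u + h *\<^sub>R v) u - f' (q + s *\<^sub>R u + 0 *\<^sub>R v) u)"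
    using MVT2[OF h, of ?\<phi> "\<lambda>s. f' (q + s *\<^sub>R u + h *\<^sub>R v) u - f' (q + s *\<^sub>R u + 0 *\<^sub>R v) u"] by blast
  obtain t where t: "0 < t" "t < h"
    and t_eq: "f' (q + s *\<^sub>R u + h *\<^sub>R v) u - f' (q + s *\<^sub>R u + 0 *\<^sub>R v) u
      = (h - 0) * fu (q + s *\<^sub>R u + t *\<^sub>R v) v"
    using MVT2[OF h, of "\<lambda>t. f' (q + s *\<^sub>R u + t *\<^sub>R v) u" "\<lambda>t. fu (q + s *\<^sub>R u + t *\<^sub>R v) v"]
      pathu[of s] s by auto
  show ?thesis
    using s t s_eq t_eq by (intro exI[of _ s] exI[of _ t]) simp
qed

text \<open>Both mixed derivatives, taken at suitable points near \<open>q\<close>, equal the same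
  second difference divided by \<open>h * h\<close>. If their values at \<open>q\<close> were a
  distance \<open>2 * e\<close> apart, continuity at \<open>q\<close> would keep them different near
  \<open>q\<close>.\<close>

lemma mixed_derivatives_commute_real:
  fixes f :: "'a::real_normed_vector \<Rightarrow> real"
  assumes S: "open S" "q \<in> S"
    and f: "\<And>p. p \<in> S \<Longrightarrow> (f has_derivative f' p) (at p)"
    and fu: "\<And>p. p \<in> S \<Longrightarrow> ((\<lambda>r. f' r u) has_derivative fu p) (at p)"
    and fv: "\<And>p. p \<in> S \<Longrightarrow> ((\<lambda>r. f' r v) has_derivative fv p) (at p)"
    and cu: "isCont (\<lambda>p. fu p v) q"
    and cv: "isCont (\<lambda>p. fv p u) q"
  shows "fu q v = fv q u"
proof (rule ccontr)
  assume ne: "fu q v \<noteq> fv q u"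
  define e where "e = dist (fu q v) (fv q u) / 2"
  have e: "e > 0" using ne by (simp add: e_def)
  obtain d0 where d0: "d0 > 0" "ball q d0 \<subseteq> S"
    using S open_contains_ball by blast
  obtain d1 where d1: "d1 > 0" "\<And>p. dist p q < d1 \<Longrightarrow> dist (fu p v) (fu q v) < e"
    using cu e unfolding continuous_at_eps_delta by (metis dist_commute dist_norm)
  obtain d2 where d2: "d2 > 0" "\<And>p. dist p q < d2 \<Longrightarrow> dist (fv p u) (fv q u) < e"
    using cv e unfolding continuous_at_eps_delta by (metis dist_commute dist_norm)
  define d where "d = min d0 (min d1 d2)"
  \<comment> \<open>With this \<open>h\<close> the parallelogram spanned by
    \<open>h *\<^sub>R u\<close> and \<open>h *\<^sub>R v\<close> stays within distance
    \<open>d\<close> of \<open>q\<close>; the summand 1 covers \<open>u = v = 0\<close> and makes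
    the estimate strict.\<close>
  define h where "h = d / (norm u + norm v + 1)"
  have d: "d > 0" using d0 d1 d2 by (simp add: d_def)
  have h: "h > 0" using d by (simp add: h_def add_nonneg_pos)
  have "norm u + norm v + 1 > 0" by (simp add: add_nonneg_pos)
  then have "h * (norm u + norm v + 1) = d" by (simp add: h_def)
  then have hd: "h * (norm u + norm v) < d"
    using h by (simp add: distrib_left)
  \<comment> \<open>The pair \<open>a\<close>, \<open>b\<close> is later \<open>u\<close>,
    \<open>v\<close> and also \<open>v\<close>, \<open>u\<close>, one for each order of
    differentiation.\<close>
  have near: "dist (q + s *\<^sub>R a + t *\<^sub>R b) q < d"
    if "0 \<le> s" "s \<le> h" "0 \<le> t" "t \<le> h" "norm a + norm b = norm u + norm v" for s t a b
  proof -
    have "dist (q + s *\<^sub>R a + t *\<^sub>R b) q = norm (s *\<^sub>R a + t *\<^sub>R b)"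
      by (simp add: dist_norm)
    also have "\<dots> \<le> s * norm a + t * norm b"
      using that by (metis norm_triangle_ineq norm_scaleR abs_of_nonneg)
    also have "\<dots> \<le> h * norm a + h * norm b"
      using that by (intro add_mono mult_right_mono) auto
    also have "\<dots> < d" using hd that(5) by (simp flip: distrib_left)
    finally show ?thesis .
  qed
  have inS: "q + s *\<^sub>R a + t *\<^sub>R b \<in> S"
    if "0 \<le> s" "s \<le> h" "0 \<le> t" "t \<le> h" "norm a + norm b = norm u + norm v" for s t a b
    using near[OF that] d0 by (auto simp: d_def dist_commute subset_iff)
  obtain s t where st: "0 < s" "s < h" "0 < t" "t < h"
    "f (q + h *\<^sub>R u + h *\<^sub>R v) - f (q + h *\<^sub>R u) - f (q + h *\<^sub>R v) + f q
      = h * h * fu (q + s *\<^sub>R u + t *\<^sub>R v) v"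
    using second_difference_mean_value[of h q u v S f f' fu, OF inS f fu h] by auto
  obtain s' t' where st': "0 < s'" "s' < h" "0 < t'" "t' < h"
    "f (q + h *\<^sub>R v + h *\<^sub>R u) - f (q + h *\<^sub>R v) - f (q + h *\<^sub>R u) + f q
      = h * h * fv (q + s' *\<^sub>R v + t' *\<^sub>R u) u"
    using second_difference_mean_value[of h q v u S f f' fv, OF inS f fv h] by (auto simp: add.commute)
  have "h * h * fu (q + s *\<^sub>R u + t *\<^sub>R v) v = h * h * fv (q + s' *\<^sub>R v + t' *\<^sub>R u) u"
    using st(5) st'(5) by (simp add: algebra_simps)
  then have eq: "fu (q + s *\<^sub>R u + t *\<^sub>R v) v = fv (q + s' *\<^sub>R v + t' *\<^sub>R u) u"
    using h by simp
  have "dist (fu (q + s *\<^sub>R u + t *\<^sub>R v) v) (fu q v) < e"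
    using near[of s t u v] st by (intro d1) (simp add: d_def)
  moreover have "dist (fv (q + s' *\<^sub>R v + t' *\<^sub>R u) u) (fv q u) < e"
    using near[of s' t' v u] st' by (intro d2) (simp add: d_def)
  ultimately show False
    using eq dist_triangle_half_r unfolding e_def by (metis less_irrefl)
qed

text \<open>Pairing with a fixed vector \<open>c\<close> reduces this to the real case, and the
  inner products with all \<open>c\<close> determine a vector.\<close>

lemma mixed_derivatives_commute:
  fixes f :: "'a::real_normed_vector \<Rightarrow> 'b::real_inner"
  assumes S: "open S" "q \<in> S"
    and f: "\<And>p. p \<in> S \<Longrightarrow> (f has_derivative f' p) (at p)"
    and fu: "\<And>p. p \<in> S \<Longrightarrow> ((\<lambda>r. f' r u) has_derivative fu p) (at p)"
    and fv: "\<And>p. p \<in> S \<Longrightarrow> ((\<lambda>r. f' r v) has_derivative fv p) (at p)"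
    and cu: "isCont (\<lambda>p. fu p v) q"
    and cv: "isCont (\<lambda>p. fv p u) q"
  shows "fu q v = fv q u"
proof -
  have "c \<bullet> fu q v = c \<bullet> fv q u" for c
    by (rule mixed_derivatives_commute_real[OF S, of "\<lambda>p. c \<bullet> f p" "\<lambda>p h. c \<bullet> f' p h" u
          "\<lambda>p h. c \<bullet> fu p h" v "\<lambda>p h. c \<bullet> fv p h"])
      (auto intro!: has_derivative_inner_right f fu fv continuous_intros cu cv)
  then show ?thesis by (metis vector_eq_ldot)
qed

section \<open>Consequences of smoothness\<close>

lemma smooth_onD:
  assumes "smooth_on S f"
  shows smooth_on_differentiable: "p \<in> S \<Longrightarrow> f differentiable (at p)"
    and smooth_on_frechet_derivative: "smooth_on S (\<lambda>p. frechet_derivative f (at p) v)"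
    and smooth_on_imp_continuous_on: "continuous_on S f"
proof -
  have C: "C_k_on k S f" for k using assms by (simp add: smooth_on_def)
  show "p \<in> S \<Longrightarrow> f differentiable (at p)" using C[of "Suc 0"] by simp
  show "smooth_on S (\<lambda>p. frechet_derivative f (at p) v)"
    unfolding smooth_on_def
  proof
    fix k show "C_k_on k S (\<lambda>p. frechet_derivative f (at p) v)" using C[of "Suc k"] by simp
  qed
  show "continuous_on S f" using C[of 0] by simp
qed

lemma smooth_on_has_derivative:
  "smooth_on S f \<Longrightarrow> p \<in> S \<Longrightarrow> (f has_derivative frechet_derivative f (at p)) (at p)"
  using smooth_on_differentiable frechet_derivative_works by blast

lemma smooth_on_second_derivative_symmetric:
  fixes f :: "'a::euclidean_space \<Rightarrow> 'b::real_inner"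
  assumes "open S" "smooth_on S f" "q \<in> S"
  shows "frechet_derivative (\<lambda>p. frechet_derivative f (at p) u) (at q) v
       = frechet_derivative (\<lambda>p. frechet_derivative f (at p) v) (at q) u"
proof -
  note s1 = smooth_on_frechet_derivative[OF assms(2)]
  have "isCont (\<lambda>p. frechet_derivative (\<lambda>r. frechet_derivative f (at r) a) (at p) b) q" for a b
    using smooth_on_imp_continuous_on[OF smooth_on_frechet_derivative[OF s1]] assms(1,3)
    by (metis continuous_on_eq_continuous_at)
  then show ?thesis
    by (intro mixed_derivatives_commute[OF assms(1,3), where f = f and f' = "\<lambda>p. frechet_derivative f (at p)"
          and fu = "\<lambda>p. frechet_derivative (\<lambda>r. frechet_derivative f (at r) u) (at p)"
          and fv = "\<lambda>p. frechet_derivative (\<lambda>r. frechet_derivative f (at r) v) (at p)"]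
        smooth_on_has_derivative[OF assms(2)] smooth_on_has_derivative[OF s1])
qed

section \<open>Matrices\<close>

lemma matrix_inv_cancel:
  fixes A :: "'a::field^'n^'n"
  assumes "det A \<noteq> 0"
  shows "A ** matrix_inv A = mat 1" "matrix_inv A ** A = mat 1"
proof -
  have "\<exists>A'. A ** A' = mat 1 \<and> A' ** A = mat 1"
    using assms invertible_det_nz[of A] by (simp add: invertible_def)
  from someI_ex[OF this] show "A ** matrix_inv A = mat 1" "matrix_inv A ** A = mat 1"
    by (simp_all add: matrix_inv_def)
qed

lemma adj2_nth [simp]:
  "adj2 A $ 1 $ 1 = A $ 2 $ 2" "adj2 A $ 1 $ 2 = - A $ 1 $ 2"
  "adj2 A $ 2 $ 1 = - A $ 2 $ 1" "adj2 A $ 2 $ 2 = A $ 1 $ 1"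
  by (simp_all add: adj2_def)

lemma matrix_mult_add_left:
  fixes A B :: "'a::semiring_1^'n^'m" and C :: "'a^'k^'n"
  shows "(A + B) ** C = A ** C + B ** C"
  by (simp add: vec_eq_iff matrix_matrix_mult_def sum.distrib distrib_right)

lemma adj2_cancel:
  fixes A :: "real^2^2"
  shows "A ** adj2 A = det A *\<^sub>R mat 1" "adj2 A ** A = det A *\<^sub>R mat 1"
  by (simp_all add: vec_eq_iff forall_2 matrix_matrix_mult_def sum_2 mat_def det_2)

lemma matrix_inv_2:
  fixes A :: "real^2^2"
  assumes "det A \<noteq> 0"
  shows "matrix_inv A = (1 / det A) *\<^sub>R adj2 A"
proof -
  \<comment> \<open>The product of the inverse, \<open>A\<close> and the adjugate is bracketed in
    the two possible ways.\<close>
  have "matrix_inv A ** (A ** adj2 A) = det A *\<^sub>R matrix_inv A"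
    by (simp add: adj2_cancel matrix_scalar_ac scalar_matrix_assoc)
  then have "adj2 A = det A *\<^sub>R matrix_inv A"
    by (simp add: matrix_mul_assoc matrix_inv_cancel[OF assms])
  then show ?thesis using assms by simp
qed

section \<open>Continuity of matrix operations\<close>

lemma continuous_on_matrix_mult:
  fixes A :: "'a::topological_space \<Rightarrow> real^'n^'m" and B :: "'a \<Rightarrow> real^'k^'n"
  assumes "continuous_on S A" "continuous_on S B"
  shows "continuous_on S (\<lambda>q. A q ** B q)"
  unfolding matrix_matrix_mult_def by (intro continuous_intros assms)

lemma continuous_on_transpose:
  fixes A :: "'a::topological_space \<Rightarrow> real^'n^'m"
  assumes "continuous_on S A"
  shows "continuous_on S (\<lambda>q. transpose (A q))"
  unfolding transpose_def by (intro continuous_intros assms)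

lemma continuous_on_det_2:
  fixes A :: "'a::topological_space \<Rightarrow> real^2^2"
  assumes "continuous_on S A"
  shows "continuous_on S (\<lambda>q. det (A q))"
  unfolding det_2 by (intro continuous_intros assms)

lemma continuous_on_adj2:
  fixes A :: "'a::topological_space \<Rightarrow> real^2^2"
  assumes "continuous_on S A"
  shows "continuous_on S (\<lambda>q. adj2 (A q))"
proof -
  have "adj2 B = (\<chi> k l. if k = 1 then if l = 1 then B$2$2 else - B$1$2
      else if l = 1 then - B$2$1 else B$1$1)" for B
    by (simp add: vec_eq_iff forall_2)
  moreover have "continuous_on S (\<lambda>q. if k = (1::2) then if l = (1::2) then A q$2$2 else - A q$1$2
      else if l = 1 then - A q$2$1 else A q$1$1)" for k l
    using assms by (cases "k = 1"; cases "l = 1") (auto intro!: continuous_intros)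
  ultimately show ?thesis by (auto intro!: continuous_intros)
qed

lemma continuous_on_matrix_inv_2:
  fixes A :: "'a::topological_space \<Rightarrow> real^2^2"
  assumes "continuous_on S A" "\<And>q. q \<in> S \<Longrightarrow> det (A q) \<noteq> 0"
  shows "continuous_on S (\<lambda>q. matrix_inv (A q))"
proof -
  have "continuous_on S (\<lambda>q. (1 / det (A q)) *\<^sub>R adj2 (A q))"
    using assms(2) by (intro continuous_intros continuous_on_det_2 continuous_on_adj2 assms(1)) auto
  then show ?thesis
    by (rule continuous_on_eq) (simp add: matrix_inv_2 assms(2))
qed

text \<open>This is Lagrange's identity; it makes the Gram determinant of a tangent moving basis
  positive.\<close>

lemma det_gram_cross3:
  fixes A :: "real^2^3"
  shows "det (transpose A ** A) = (norm (cross3 (column 1 A) (column 2 A)))\<^sup>2"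
  unfolding norm_cross unfolding power2_norm_eq_inner
  by (simp add: det_2 matrix_matrix_mult_def transpose_def column_def inner_vec_def sum_3
      power2_eq_square algebra_simps)

lemma cross3_independent_nonzero:
  assumes "w1 \<noteq> w2" "independent {w1, w2}"
  shows "cross3 w1 w2 \<noteq> 0"
proof
  assume "cross3 w1 w2 = 0"
  then consider "w1 = 0" | "w2 = 0" | c where "w2 = c *\<^sub>R w1"
    by (auto simp: cross_eq_0 collinear_lemma)
  then show False
  proof cases
    case 3
    then have "w2 \<in> span ({w1, w2} - {w2})"
      using assms(1) by (auto simp: span_base span_scale insert_Diff_if)
    then show ?thesis using assms(2) dependent_def by blast
  qed (use assms(2) dependent_zero in auto)
qed

text \<open>The span condition gives \<open>X = A ** Y\<close> for some \<open>Y\<close>, and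
  multiplying \<open>transpose X ** A\<close> by the inverse Gram matrix recovers
  \<open>transpose Y\<close>. With \<open>X = D x\<close> and \<open>A = \<Omega>\<close> the
  recovered matrix is \<Lambda>.\<close>

lemma matrix_eq_mult_of_columns_in_span:
  fixes X A :: "real^2^3"
  assumes "det (transpose A ** A) \<noteq> 0"
    and "\<And>l. column l X \<in> span {column 1 A, column 2 A}"
  shows "X = A ** transpose (transpose X ** A ** matrix_inv (transpose A ** A))"
proof -
  have "\<exists>a b. column l X = a *\<^sub>R column 1 A + b *\<^sub>R column 2 A" for l
    using assms(2)[of l] by (auto simp: span_insert span_singleton algebra_simps)
  then obtain a b where ab: "\<And>l. column l X = a l *\<^sub>R column 1 A + b l *\<^sub>R column 2 A"
    by metis
  define Y :: "real^2^2" where "Y = (\<chi> k l. if k = 1 then a l else b l)"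
  have X: "X = A ** Y"
    using ab by (simp add: vec_eq_iff column_def matrix_matrix_mult_def sum_2 Y_def mult.commute)
  have "transpose X ** A ** matrix_inv (transpose A ** A)
      = transpose Y ** ((transpose A ** A) ** matrix_inv (transpose A ** A))"
    by (simp add: X matrix_transpose_mul matrix_mul_assoc)
  then show ?thesis
    by (simp add: X matrix_inv_cancel(1)[OF assms(1)])
qed

text \<open>For 2 by 2 matrices the adjugate is linear, so
  \<open>A ** adj2 A = det A *\<^sub>R mat 1\<close> is quadratic in \<open>A\<close>; this is its
  bilinear part at \<open>L\<close> and \<open>M\<close>.\<close>

lemma adj2_polarised_Cayley_Hamilton:
  fixes L M :: "real^2^2"
  shows "M ** adj2 L + L ** adj2 M = trace (M ** adj2 L) *\<^sub>R mat 1"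
  by (simp add: vec_eq_iff forall_2 matrix_matrix_mult_def sum_2 mat_def trace_def algebra_simps)

text \<open>The polarised identity is multiplied by the symmetric matrix \<open>?T\<close>. Written
  as \<open>L ** I ** transpose M\<close> it lets \<open>adj2 L\<close> meet \<open>L\<close>;
  written as \<open>M ** I ** transpose L\<close> it lets \<open>adj2 M\<close> meet
  \<open>M\<close>.\<close>

lemma trace_adj2_scaleR_symmetric_product:
  fixes L M I :: "real^2^2"
  assumes "transpose I = I"
    and "transpose (L ** I ** transpose M) = L ** I ** transpose M" (is "_ = ?T")
  shows "trace (M ** adj2 L) *\<^sub>R (L ** I ** transpose M)
    = det L *\<^sub>R (M ** I ** transpose M) + det M *\<^sub>R (L ** I ** transpose L)"
proof -
  have T: "?T = M ** I ** transpose L"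
    using assms by (simp add: matrix_transpose_mul matrix_mul_assoc)
  have "trace (M ** adj2 L) *\<^sub>R ?T = (M ** adj2 L + L ** adj2 M) ** ?T"
    by (simp add: adj2_polarised_Cayley_Hamilton flip: scalar_matrix_assoc)
  also have "\<dots> = M ** (adj2 L ** L) ** I ** transpose M + L ** adj2 M ** ?T"
    by (simp add: matrix_mult_add_left matrix_mul_assoc)
  also have "L ** adj2 M ** ?T = L ** (adj2 M ** M) ** I ** transpose L"
    by (simp add: T matrix_mul_assoc)
  finally show ?thesis
    by (simp add: adj2_cancel matrix_scalar_ac flip: scalar_matrix_assoc)
qed

text \<open>The discriminant of \<open>det (S - t B)\<close> is nonnegative for symmetric
  \<open>S\<close> and positive semidefinite \<open>B\<close>: after multiplication by
  \<open>E\<^sup>2\<close> it is a sum of nonnegative terms.\<close>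

lemma quadratic_pencil_discriminant:
  fixes E F G e f g :: real
  assumes "E > 0" "E * G - F\<^sup>2 \<ge> 0"
  shows "4 * (E * G - F\<^sup>2) * (e * g - f\<^sup>2) \<le> (e * G + g * E - 2 * f * F)\<^sup>2"
proof -
  have "E\<^sup>2 * ((e * G + g * E - 2 * f * F)\<^sup>2 - 4 * (E * G - F\<^sup>2) * (e * g - f\<^sup>2))
    = 4 * (E * G - F\<^sup>2) * (E * f - F * e)\<^sup>2 + (E * (E * g - G * e) - 2 * F * (E * f - F * e))\<^sup>2"
    by (simp add: power2_eq_square algebra_simps)
  also have "\<dots> \<ge> 0" using assms by simp
  finally show ?thesis using assms by (simp add: zero_le_mult_iff)
qed

lemma adj2_mult: "adj2 (A ** B) = adj2 B ** adj2 A"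
  by (simp add: vec_eq_iff forall_2 matrix_matrix_mult_def sum_2 algebra_simps)

text \<open>The adjugate reverses products, so \<open>adj2 L\<close> meets \<open>L\<close> and then
  \<open>adj2 I\<close> meets \<open>I\<close>; each pair collapses to a determinant. This trace is,
  up to sign, the numerator of the mean curvature.\<close>

lemma trace_adj2_congruence:
  fixes L M I :: "real^2^2"
  shows "trace (adj2 (L ** I ** transpose L) ** (L ** I ** transpose M))
    = det L * det I * trace (M ** adj2 L)"
proof -
  have "adj2 (L ** I ** transpose L) ** (L ** I ** transpose M)
      = adj2 (transpose L) ** (adj2 I ** (adj2 L ** L) ** I) ** transpose M"
    by (simp add: adj2_mult matrix_mul_assoc)
  also have "\<dots> = (det L * det I) *\<^sub>R (adj2 (transpose L) ** transpose M)"
    by (simp add: adj2_cancel matrix_scalar_ac flip: scalar_matrix_assoc)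
  finally show ?thesis
    by (simp add: trace_def sum_2 matrix_matrix_mult_def transpose_def algebra_simps)
qed

section \<open>Derivatives and bounds\<close>

lemma frechet_derivative_eq_jacobian:
  fixes f :: "real^'n \<Rightarrow> real^'m"
  shows "f differentiable (at p) \<Longrightarrow> frechet_derivative f (at p) = (*v) (jacobian f (at p))"
  using frechet_derivative_at[of f _ p] jacobian_works[of f "at p"] by force

lemma column_jacobian:
  fixes f :: "real^'n \<Rightarrow> real^'m"
  assumes "f differentiable (at p)"
  shows "column l (jacobian f (at p)) = frechet_derivative f (at p) (axis l 1)"
  by (simp add: frechet_derivative_eq_jacobian[OF assms] matrix_vector_mult_basis)

lemma transpose_mult_nth:
  fixes A :: "real^'n^'m" and B :: "real^'k^'m"
  shows "(transpose A ** B) $ k $ l = column k A \<bullet> column l B"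
  by (simp add: matrix_matrix_mult_def transpose_def inner_vec_def column_def)

lemma continuous_on_jacobian:
  assumes "\<And>q. q \<in> S \<Longrightarrow> f differentiable (at q)"
    and "\<And>v. continuous_on S (\<lambda>q. frechet_derivative f (at q) v)"
  shows "continuous_on S (\<lambda>q. jacobian f (at q))"
  unfolding jacobian_def matrix_def
  by (intro continuous_intros assms(2))

text \<open>The explicit formula serves to read off the continuity of the derivative of the unit
  normal.\<close>

lemma has_derivative_normalize:
  fixes c :: "'a::real_normed_vector \<Rightarrow> 'b::real_inner"
  assumes c: "(c has_derivative c') (at p)" and nz: "c p \<noteq> 0"
  shows "((\<lambda>q. (1 / norm (c q)) *\<^sub>R c q) has_derivative
    (\<lambda>h. (1 / norm (c p)) *\<^sub>R c' h - (c p \<bullet> c' h / norm (c p) ^ 3) *\<^sub>R c p)) (at p)"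
proof -
  have n: "((\<lambda>q. norm (c q)) has_derivative (\<lambda>h. c' h \<bullet> sgn (c p))) (at p)"
    using has_derivative_compose[OF c has_derivative_norm[OF nz]] by (simp add: o_def)
  show ?thesis
    using nz
    by (auto intro!: derivative_eq_intros c n simp: fun_eq_iff sgn_div_norm inner_commute power3_eq_cube divide_simps)
qed

text \<open>The inequality is a closed condition, so it passes from the dense subset
  \<open>R\<close> to \<open>W\<close>. It carries bounds from regular to singular points.\<close>

lemma abs_bound_closure:
  fixes f g :: "'a::topological_space \<Rightarrow> real"
  assumes "continuous_on W f" "continuous_on W g" "closed W" "R \<subseteq> W" "W \<subseteq> closure R"
    and "\<And>q. q \<in> R \<Longrightarrow> \<bar>f q\<bar> \<le> C * \<bar>g q\<bar>" and "q \<in> W"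
  shows "\<bar>f q\<bar> \<le> C * \<bar>g q\<bar>"
proof -
  have W: "closure R = W" using assms(3-5) closure_minimal by blast
  have "\<bar>f q\<bar> - C * \<bar>g q\<bar> \<le> 0"
    by (rule continuous_le_on_closure[of R "\<lambda>q. \<bar>f q\<bar> - C * \<bar>g q\<bar>"])
      (use assms W in \<open>auto intro!: continuous_intros\<close>)
  then show ?thesis by simp
qed

lemma compact_continuous_abs_bound:
  fixes f :: "'a::topological_space \<Rightarrow> real"
  assumes "compact W" "continuous_on W f"
  obtains B where "B > 0" "\<And>q. q \<in> W \<Longrightarrow> \<bar>f q\<bar> \<le> B"
  using compact_imp_bounded[OF compact_continuous_image[OF assms(2,1)]] bounded_pos[of "f ` W"]
  by auto

lemma compact_continuous_abs_lower_bound: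
  fixes f :: "'a::topological_space \<Rightarrow> real"
  assumes "compact W" "continuous_on W f" "\<And>q. q \<in> W \<Longrightarrow> f q \<noteq> 0"
  obtains b where "b > 0" "\<And>q. q \<in> W \<Longrightarrow> b \<le> \<bar>f q\<bar>"
proof -
  have "continuous_on W (\<lambda>q. 1 / f q)" using assms by (intro continuous_intros) auto
  then obtain B where B: "B > 0" "\<And>q. q \<in> W \<Longrightarrow> \<bar>1 / f q\<bar> \<le> B"
    using compact_continuous_abs_bound[OF assms(1)] by blast
  have "1 / B \<le> \<bar>f q\<bar>" if "q \<in> W" for q
    using B(1) B(2)[OF that] assms(3)[OF that] by (simp add: abs_divide divide_le_eq mult.commute)
  then show ?thesis using B(1) by (intro that[of "1 / B"]) auto
qed

section \<open>Curvatures relative to a tangent moving basis\<close>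

locale tangent_basis =
  fixes U :: "(real^2) set" and x :: "real^2 \<Rightarrow> real^3" and \<Omega> :: "real^2 \<Rightarrow> real^2^3"
  assumes open_U: "open U"
    and smooth_x: "smooth_on U x"
    and tmb: "tangent_moving_basis U x \<Omega>"
begin

section \<open>Factorisation of the fundamental forms through the basis\<close>

lemma smooth_Omega: "smooth_on U \<Omega>"
  using tmb by (simp add: tangent_moving_basis_def)

lemma cross_columns_nonzero:
  assumes "q \<in> U"
  shows "cross3 (column 1 (\<Omega> q)) (column 2 (\<Omega> q)) \<noteq> 0"
  using tmb assms by (intro cross3_independent_nonzero) (auto simp: tangent_moving_basis_def Let_def)

lemma I_rel_pos: "q \<in> U \<Longrightarrow> det (I_rel \<Omega> q) > 0"
  using cross_columns_nonzero by (simp add: I_rel_def det_gram_cross3)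

lemma transpose_I_rel: "transpose (I_rel \<Omega> q) = I_rel \<Omega> q"
  by (simp add: I_rel_def matrix_transpose_mul)

lemma D_x:
  assumes "q \<in> U"
  shows "D x q = \<Omega> q ** transpose (Lambda_rel x \<Omega> q)"
  unfolding Lambda_rel_def I_rel_def
proof (rule matrix_eq_mult_of_columns_in_span)
  show "det (transpose (\<Omega> q) ** \<Omega> q) \<noteq> 0"
    using I_rel_pos[OF assms] by (simp add: I_rel_def)
  show "column l (D x q) \<in> span {column 1 (\<Omega> q), column 2 (\<Omega> q)}" for l
    using tmb assms exhaust_2[of l] smooth_on_differentiable[OF smooth_x assms]
    by (auto simp: tangent_moving_basis_def Let_def column_jacobian)
qed

lemma first_form_eq:
  assumes "q \<in> U"
  shows "first_form x q
    = Lambda_rel x \<Omega> q ** I_rel \<Omega> q ** transpose (Lambda_rel x \<Omega> q)"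
  by (simp add: first_form_def I_rel_def D_x[OF assms] matrix_transpose_mul matrix_mul_assoc)

text \<open>From \<open>D x = \<Omega> ** transpose L\<close> the second form is
  \<open>L ** II\<close>, and \<open>I ** transpose M = - II\<close> because the inverse of the
  symmetric matrix \<open>I\<close> is symmetric.\<close>

lemma second_form_eq:
  assumes "q \<in> U"
  shows "second_form x \<Omega> q
    = - (Lambda_rel x \<Omega> q ** I_rel \<Omega> q ** transpose (mu_rel \<Omega> q))"
proof -
  define J where "J = matrix_inv (I_rel \<Omega> q)"
  have d: "det (I_rel \<Omega> q) \<noteq> 0" using I_rel_pos[OF assms] by simp
  have IJ: "I_rel \<Omega> q ** J = mat 1"
    unfolding J_def by (rule matrix_inv_cancel[OF d])
  have "J = transpose J ** (transpose (I_rel \<Omega> q) ** J)" 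
    using IJ by (metis matrix_mul_assoc matrix_mul_lid matrix_transpose_mul transpose_mat)
  then have tJ: "transpose J = J"
    by (simp add: transpose_I_rel IJ)
  have tm: "transpose (- A) = - transpose A" for A :: "real^2^2"
    by (simp add: transpose_def vec_eq_iff)
  have mm: "A ** (- B) = - (A ** B)" for A :: "real^'a^'c" and B :: "real^'b^'a"
    by (simp add: matrix_matrix_mult_def vec_eq_iff sum_negf)
  have "I_rel \<Omega> q ** transpose (mu_rel \<Omega> q) = - II_rel \<Omega> q"
    by (simp add: mu_rel_def tm mm matrix_transpose_mul tJ[unfolded J_def] matrix_mul_assoc
        IJ[unfolded J_def])
  then show ?thesis
    by (simp add: second_form_def II_rel_def D_x[OF assms] matrix_transpose_mul matrix_mul_assoc mm
        flip: matrix_mul_assoc)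
qed

section \<open>The unit normal and the symmetry of the second form\<close>

lemma tmb_normal_C1:
  shows tmb_normal_differentiable: "q \<in> U \<Longrightarrow> tmb_normal \<Omega> differentiable (at q)"
    and tmb_normal_continuous_derivative:
      "continuous_on U (\<lambda>q. frechet_derivative (tmb_normal \<Omega>) (at q) v)"
proof -
  \<comment> \<open>Here \<open>c\<close> is the normal before normalisation, \<open>c'\<close> its
    derivative by the product rule for the cross product, and \<open>n'\<close> the resulting
    derivative of the unit normal.\<close>
  define c where "c q = cross3 (column 1 (\<Omega> q)) (column 2 (\<Omega> q))" for q
  define c' where "c' q h = cross3 (column 1 (\<Omega> q)) (column 2 (frechet_derivative \<Omega> (at q) h))
      + cross3 (column 1 (frechet_derivative \<Omega> (at q) h)) (column 2 (\<Omega> q))" for q h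
  define n' where "n' q h = (1 / norm (c q)) *\<^sub>R c' q h - (c q \<bullet> c' q h / norm (c q) ^ 3) *\<^sub>R c q" for q h
  have col: "bounded_linear (column l :: real^2^3 \<Rightarrow> _)" for l
    by (rule linear_conv_bounded_linear[THEN iffD1])
      (auto intro!: linearI simp: column_def vec_eq_iff)
  have c: "(c has_derivative c' q) (at q)" if "q \<in> U" for q
    unfolding c_def c'_def
    by (rule bounded_bilinear.FDERIV[OF bilinear_conv_bounded_bilinear[THEN iffD1, OF bilinear_cross]];
        rule bounded_linear.has_derivative[OF col smooth_on_has_derivative[OF smooth_Omega that]])
  have nz: "c q \<noteq> 0" if "q \<in> U" for q
    using cross_columns_nonzero[OF that] by (simp add: c_def)
  have n: "(tmb_normal \<Omega> has_derivative n' q) (at q)" if "q \<in> U" for q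
    using has_derivative_normalize[OF c nz, OF that that]
    unfolding n'_def tmb_normal_def c_def Let_def .
  show "q \<in> U \<Longrightarrow> tmb_normal \<Omega> differentiable (at q)"
    using n by (auto simp: differentiable_def)
  note colc = bounded_linear.continuous_on[OF col]
  have cc: "continuous_on U c" "continuous_on U (\<lambda>q. c' q v)" for v
    unfolding c_def c'_def
    by (intro continuous_on_add continuous_on_cross colc smooth_on_imp_continuous_on smooth_Omega
        smooth_on_frechet_derivative)+
  have "continuous_on U (\<lambda>q. n' q v)"
    unfolding n'_def by (intro continuous_intros cc) (auto simp: nz)
  then show "continuous_on U (\<lambda>q. frechet_derivative (tmb_normal \<Omega>) (at q) v)"
    by (rule continuous_on_eq) (simp add: frechet_derivative_at[OF n])
qed

lemma tmb_normal_orthogonal: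
  assumes "q \<in> U"
  shows "frechet_derivative x (at q) (axis l 1) \<bullet> tmb_normal \<Omega> q = 0"
proof -
  let ?n = "tmb_normal \<Omega> q"
  have "frechet_derivative x (at q) (axis l 1) \<in> span {column 1 (\<Omega> q), column 2 (\<Omega> q)}"
    using tmb assms exhaust_2[of l] by (auto simp: tangent_moving_basis_def Let_def)
  moreover have "orthogonal ?n w" if "w \<in> {column 1 (\<Omega> q), column 2 (\<Omega> q)}" for w
    using that by (auto simp: tmb_normal_def Let_def orthogonal_def dot_cross_self)
  ultimately have "orthogonal ?n (frechet_derivative x (at q) (axis l 1))"
    using orthogonal_to_span by blast
  then show ?thesis by (simp add: orthogonal_def inner_commute)
qed

text \<open>Differentiating \<open>n \<bullet> x\<^sub>k = 0\<close> gives \<open>n\<^sub>l \<bullet> x\<^sub>k = - n \<bullet> x\<^sub>k\<^sub>l\<close>.\<close>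

lemma second_form_symmetric:
  assumes "q \<in> U"
  shows "transpose (second_form x \<Omega> q) = second_form x \<Omega> q"
proof -
  let ?n = "tmb_normal \<Omega>"
  let ?x = "\<lambda>k r. frechet_derivative x (at r) (axis k 1)"
  have nd: "?n differentiable (at q)" and xd: "x differentiable (at q)"
    using tmb_normal_differentiable smooth_on_differentiable[OF smooth_x] assms by auto
  have *: "?x k q \<bullet> frechet_derivative ?n (at q) (axis l 1)
      = - (frechet_derivative (?x k) (at q) (axis l 1) \<bullet> ?n q)" for k l
  proof -
    have "((\<lambda>r. ?x k r \<bullet> ?n r) has_derivative
       (\<lambda>h. ?x k q \<bullet> frechet_derivative ?n (at q) h + frechet_derivative (?x k) (at q) h \<bullet> ?n q)) (at q)"
      using has_derivative_inner[OF smooth_on_has_derivative[OF smooth_on_frechet_derivative[OF smooth_x]]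
        frechet_derivative_works[THEN iffD1, OF nd], OF assms] .
    moreover have "((\<lambda>r. ?x k r \<bullet> ?n r) has_derivative (\<lambda>h. 0)) (at q)"
      by (rule has_derivative_transform_within_open[OF has_derivative_const open_U assms])
        (simp add: tmb_normal_orthogonal)
    ultimately show ?thesis
      using has_derivative_unique by (metis (lifting) add_eq_0_iff2)
  qed
  have "second_form x \<Omega> q $ k $ l = frechet_derivative (?x k) (at q) (axis l 1) \<bullet> ?n q" for k l
    by (simp add: second_form_def transpose_mult_nth column_jacobian nd xd *)
  then show ?thesis
    by (simp add: transpose_def vec_eq_iff smooth_on_second_derivative_symmetric[OF open_U smooth_x assms])
qed

section \<open>Singular set and continuity of the relative matrices\<close>

lemma singular_iff:
  assumes "q \<in> U"
  shows "q \<in> singular_set U x \<longleftrightarrow> lambda_rel x \<Omega> q = 0"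
proof -
  have xd: "x differentiable (at q)" by (rule smooth_on_differentiable[OF smooth_x assms])
  \<comment> \<open>The inverse of \<open>I_rel \<Omega> q\<close> times
    \<open>transpose (\<Omega> q)\<close> is a left inverse of \<open>\<Omega> q\<close>. Hence
    \<open>D x q\<close> is injective exactly when the transpose of \<Lambda> is.\<close>
  have i: "inj ((*v) (\<Omega> q))"
    unfolding matrix_left_invertible_injective[symmetric]
    using matrix_inv_cancel(2)[of "I_rel \<Omega> q"] I_rel_pos[OF assms]
    by (auto simp: I_rel_def matrix_mul_assoc)
  have "q \<in> singular_set U x \<longleftrightarrow> \<not> inj ((*v) (D x q))"
    using assms by (simp add: singular_set_def immersive_at_def xd frechet_derivative_eq_jacobian)
  also have "(*v) (D x q) = (*v) (\<Omega> q) \<circ> (*v) (transpose (Lambda_rel x \<Omega> q))"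
    unfolding D_x[OF assms] by (rule ext) (simp only: comp_apply matrix_vector_mul_assoc)
  also have "inj \<dots> \<longleftrightarrow> inj ((*v) (transpose (Lambda_rel x \<Omega> q)))"
    using i by (metis inj_compose inj_on_imageI2)
  also have "\<dots> \<longleftrightarrow> lambda_rel x \<Omega> q \<noteq> 0"
    unfolding matrix_left_invertible_injective[symmetric] invertible_left_inverse[symmetric]
      invertible_det_nz lambda_rel_def det_transpose ..
  finally show ?thesis by simp
qed

lemma continuous_on_rel:
  shows continuous_on_I_rel: "continuous_on U (I_rel \<Omega>)"
    and continuous_on_Lambda_rel: "continuous_on U (Lambda_rel x \<Omega>)"
    and continuous_on_mu_rel: "continuous_on U (mu_rel \<Omega>)"
    and continuous_on_first_form: "continuous_on U (first_form x)"
    and continuous_on_second_form: "continuous_on U (second_form x \<Omega>)"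
proof -
  have O: "continuous_on U \<Omega>" by (rule smooth_on_imp_continuous_on[OF smooth_Omega])
  have X: "continuous_on U (D x)"
    by (intro continuous_on_jacobian smooth_on_differentiable[OF smooth_x]
        smooth_on_imp_continuous_on[OF smooth_on_frechet_derivative[OF smooth_x]])
  have N: "continuous_on U (D (tmb_normal \<Omega>))"
    by (intro continuous_on_jacobian tmb_normal_differentiable tmb_normal_continuous_derivative)
  show I: "continuous_on U (I_rel \<Omega>)"
    unfolding I_rel_def by (intro continuous_on_matrix_mult continuous_on_transpose O)
  have J: "continuous_on U (\<lambda>q. matrix_inv (I_rel \<Omega> q))"
    using I I_rel_pos by (intro continuous_on_matrix_inv_2) force+
  show "continuous_on U (Lambda_rel x \<Omega>)"
    unfolding Lambda_rel_def by (intro continuous_on_matrix_mult continuous_on_transpose O X J)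
  show "continuous_on U (mu_rel \<Omega>)"
    unfolding mu_rel_def II_rel_def
    by (intro continuous_on_minus continuous_on_matrix_mult continuous_on_transpose O N J)
  show "continuous_on U (first_form x)"
    unfolding first_form_def by (intro continuous_on_matrix_mult continuous_on_transpose X)
  show "continuous_on U (second_form x \<Omega>)"
    unfolding second_form_def
    by (intro continuous_on_minus continuous_on_matrix_mult continuous_on_transpose X N)
qed

section \<open>Identities between fundamental forms and relative curvatures\<close>

abbreviation "lam \<equiv> lambda_rel x \<Omega>"
abbreviation "Kr \<equiv> K_rel \<Omega>"
abbreviation "Hr \<equiv> H_rel x \<Omega>"
abbreviation "kr \<equiv> k_rel x \<Omega>"

lemma second_form_21: "q \<in> U \<Longrightarrow> second_form x \<Omega> q $ 2 $ 1 = second_form x \<Omega> q $ 1 $ 2"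
  using arg_cong[OF second_form_symmetric, of q "\<lambda>A. A $ 1 $ 2"] by (simp add: transpose_def)

lemma first_form_21: "first_form x q $ 2 $ 1 = first_form x q $ 1 $ 2"
  by (simp add: first_form_def transpose_mult_nth inner_commute)

lemma det_second_form:
  assumes "q \<in> U"
  shows "e_coeff x \<Omega> q * g_coeff x \<Omega> q - (f_coeff x \<Omega> q)\<^sup>2 = lam q * Kr q * det (I_rel \<Omega> q)"
proof -
  have "det (- A) = det A" for A :: "real^2^2" by (simp add: det_2)
  then have "det (second_form x \<Omega> q) = lam q * Kr q * det (I_rel \<Omega> q)"
    by (simp add: second_form_eq[OF assms] det_mul det_transpose lambda_rel_def K_rel_def)
  then show ?thesis by (simp add: det_2[of "second_form x \<Omega> q"] second_form_21[OF assms] power2_eq_square)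
qed

lemma det_first_form:
  assumes "q \<in> U"
  shows "E_coeff x q * G_coeff x q - (F_coeff x q)\<^sup>2 = (lam q)\<^sup>2 * det (I_rel \<Omega> q)"
proof -
  have "det (first_form x q) = (lam q)\<^sup>2 * det (I_rel \<Omega> q)"
    by (simp add: first_form_eq[OF assms] det_mul det_transpose lambda_rel_def power2_eq_square)
  then show ?thesis by (simp add: det_2[of "first_form x q"] first_form_21 power2_eq_square)
qed

text \<open>The left side is the trace of the adjugate of the first form times the second form; the
  factor -1/2 in \<open>H_rel\<close> accounts for the 2 and the sign.\<close>

lemma mixed_discriminant_forms:
  assumes "q \<in> U"
  shows "e_coeff x \<Omega> q * G_coeff x q + g_coeff x \<Omega> q * E_coeff x q
      - 2 * f_coeff x \<Omega> q * F_coeff x q = 2 * Hr q * lam q * det (I_rel \<Omega> q)"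
proof -
  let ?L = "Lambda_rel x \<Omega> q" and ?I = "I_rel \<Omega> q" and ?M = "mu_rel \<Omega> q"
  have m: "trace (A ** (- B)) = - trace (A ** B)" for A B :: "real^2^2"
    by (simp add: trace_def matrix_matrix_mult_def sum_2)
  have "trace (adj2 (first_form x q) ** second_form x \<Omega> q)
      = - trace (adj2 (?L ** ?I ** transpose ?L) ** (?L ** ?I ** transpose ?M))"
    by (simp add: first_form_eq[OF assms] second_form_eq[OF assms] m)
  also have "\<dots> = 2 * Hr q * lam q * det ?I"
    unfolding trace_adj2_congruence by (simp add: H_rel_def lambda_rel_def)
  finally show ?thesis
    by (simp add: trace_def matrix_matrix_mult_def sum_2 first_form_21 second_form_21[OF assms] algebra_simps)
qed

lemma second_form_scaled:
  assumes "q \<in> U"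
  shows "(2 * Hr q) *\<^sub>R second_form x \<Omega> q
    = lam q *\<^sub>R (mu_rel \<Omega> q ** I_rel \<Omega> q ** transpose (mu_rel \<Omega> q)) + Kr q *\<^sub>R first_form x q"
proof -
  let ?L = "Lambda_rel x \<Omega> q" and ?I = "I_rel \<Omega> q" and ?M = "mu_rel \<Omega> q"
  have S: "?L ** ?I ** transpose ?M = - second_form x \<Omega> q"
    by (simp add: second_form_eq[OF assms])
  have "transpose (- second_form x \<Omega> q) = - second_form x \<Omega> q"
    using second_form_symmetric[OF assms] by (simp add: transpose_def vec_eq_iff)
  with trace_adj2_scaleR_symmetric_product[OF transpose_I_rel, of ?L q ?M]
  have "trace (?M ** adj2 ?L) *\<^sub>R - second_form x \<Omega> q
    = det ?L *\<^sub>R (?M ** ?I ** transpose ?M) + det ?M *\<^sub>R first_form x q"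
    by (simp add: S first_form_eq[OF assms])
  then show ?thesis by (simp add: H_rel_def lambda_rel_def K_rel_def)
qed

text \<open>At regular points the first form is positive definite, and the pencil inequality can be
  divided by \<open>4 * (lam q)\<^sup>2 * ?d\<^sup>2\<close>. Thus the root in \<open>k_rel\<close>
  is that of a nonnegative number.\<close>

lemma discriminant_nonneg:
  assumes "q \<in> U"
  shows "lam q * Kr q \<le> (Hr q)\<^sup>2"
proof (cases "lam q = 0")
  case False
  let ?d = "det (I_rel \<Omega> q)"
  have d: "?d > 0" by (rule I_rel_pos[OF assms])
  have pos: "E_coeff x q * G_coeff x q - (F_coeff x q)\<^sup>2 > 0"
    unfolding det_first_form[OF assms] using d False by simp
  \<comment> \<open>\<open>E\<close> is a squared norm, and \<open>E = 0\<close> would leave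
    \<open>- F\<^sup>2\<close> as the positive determinant.\<close>
  have "E_coeff x q \<ge> 0" "E_coeff x q \<noteq> 0"
    using pos by (auto simp: first_form_def transpose_mult_nth)
  then have "E_coeff x q > 0" by simp
  from quadratic_pencil_discriminant[OF this, of "G_coeff x q" "F_coeff x q"
      "e_coeff x \<Omega> q" "g_coeff x \<Omega> q" "f_coeff x \<Omega> q"] pos
  have "4 * ((lam q)\<^sup>2 * ?d) * (lam q * Kr q * ?d) \<le> (2 * Hr q * lam q * ?d)\<^sup>2"
    unfolding det_first_form[OF assms] det_second_form[OF assms] mixed_discriminant_forms[OF assms] by simp
  then have "(4 * (lam q)\<^sup>2 * ?d\<^sup>2) * (lam q * Kr q) \<le> (4 * (lam q)\<^sup>2 * ?d\<^sup>2) * (Hr q)\<^sup>2"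
    by (simp add: power2_eq_square algebra_simps)
  moreover have "4 * (lam q)\<^sup>2 * ?d\<^sup>2 > 0" using d False by simp
  ultimately show ?thesis by (simp only: mult_le_cancel_left_pos)
qed simp

section \<open>Relative and classical principal curvatures\<close>

lemma k_rel_sum: "i \<noteq> j \<Longrightarrow> kr i q + kr j q = 2 * Hr q"
  using exhaust_2[of i] exhaust_2[of j] by (auto simp: k_rel_def Let_def)

lemma k_rel_mult:
  assumes "q \<in> U" "i \<noteq> j"
  shows "kr i q * kr j q = lam q * Kr q"
proof -
  define r where "r = sqrt ((Hr q)\<^sup>2 - lam q * Kr q)"
  have "r\<^sup>2 = (Hr q)\<^sup>2 - lam q * Kr q"
    using discriminant_nonneg[OF assms(1)] by (simp add: r_def)
  then have "(Hr q - r) * (Hr q + r) = lam q * Kr q"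
    by (simp add: power2_eq_square algebra_simps)
  moreover have "kr 1 q = Hr q - r" "kr 2 q = Hr q + r"
    by (simp_all add: k_rel_def Let_def r_def)
  ultimately show ?thesis
    using assms(2) exhaust_2[of i] exhaust_2[of j] by (auto simp: mult.commute)
qed

lemma gauss_curv_eq:
  assumes "q \<in> U" "lam q \<noteq> 0"
  shows "gauss_curv x \<Omega> q = Kr q / lam q"
  using assms(2) I_rel_pos[OF assms(1)]
  unfolding gauss_curv_def det_first_form[OF assms(1)] det_second_form[OF assms(1)]
  by (simp add: power2_eq_square)

lemma mean_curv_eq:
  assumes "q \<in> U" "lam q \<noteq> 0"
  shows "mean_curv x \<Omega> q = Hr q / lam q"
  using assms(2) I_rel_pos[OF assms(1)]
  unfolding mean_curv_def det_first_form[OF assms(1)] mixed_discriminant_forms[OF assms(1)]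
  by (simp add: power2_eq_square)

text \<open>Taking the root divides by the absolute value of \<open>lam q\<close>; the swap of signs
  in \<open>princ_curv\<close> for negative \<open>lam q\<close> undoes this.\<close>

lemma princ_curv_eq:
  assumes "q \<in> U" "lam q \<noteq> 0"
  shows "princ_curv x \<Omega> j q = kr j q / lam q"
proof -
  have "(mean_curv x \<Omega> q)\<^sup>2 - gauss_curv x \<Omega> q = ((Hr q)\<^sup>2 - lam q * Kr q) / (lam q)\<^sup>2"
    using assms(2) by (simp add: gauss_curv_eq[OF assms] mean_curv_eq[OF assms] field_simps power2_eq_square)
  then have r: "sqrt ((mean_curv x \<Omega> q)\<^sup>2 - gauss_curv x \<Omega> q)
      = sqrt ((Hr q)\<^sup>2 - lam q * Kr q) / \<bar>lam q\<bar>"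
    by (simp add: real_sqrt_divide)
  show ?thesis
    using assms(2) unfolding princ_curv_def k_rel_def Let_def r unfolding mean_curv_eq[OF assms]
    by (auto simp: abs_if diff_divide_distrib add_divide_distrib)
qed

text \<open>At regular points this is \<open>kr i q * kr j q = lam q * Kr q\<close> rearranged; at
  singular points it is the chosen extension.\<close>

lemma princ_curv_ext_eq:
  assumes "q \<in> U" "i \<noteq> j" "kr i q \<noteq> 0"
  shows "princ_curv_ext U x \<Omega> i j q = Kr q / kr i q"
proof (cases "lam q = 0")
  case False
  have "kr j q / lam q = Kr q / kr i q"
    using k_rel_mult[OF assms(1,2)] by (simp add: frac_eq_eq[OF False assms(3)] mult.commute)
  then show ?thesis
    using False by (simp add: princ_curv_ext_def princ_curv_eq[OF assms(1)] singular_iff[OF assms(1)])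
qed (simp add: princ_curv_ext_def singular_iff[OF assms(1)])

lemma continuous_on_curvatures:
  shows continuous_on_lambda_rel: "continuous_on U lam"
    and continuous_on_K_rel: "continuous_on U Kr"
    and continuous_on_k_rel: "continuous_on U (kr i)"
proof -
  show l: "continuous_on U lam" and K: "continuous_on U Kr"
    unfolding lambda_rel_def K_rel_def
    by (intro continuous_on_det_2 continuous_on_Lambda_rel continuous_on_mu_rel)+
  have "continuous_on U (\<lambda>q. mu_rel \<Omega> q ** adj2 (Lambda_rel x \<Omega> q))"
    by (intro continuous_on_matrix_mult continuous_on_adj2 continuous_on_mu_rel continuous_on_Lambda_rel)
  then have H: "continuous_on U Hr"
    unfolding H_rel_def trace_def by (intro continuous_intros)
  show "continuous_on U (kr i)"
    unfolding k_rel_def Let_def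
    by (cases "i = 1") (auto intro!: continuous_intros H K l)
qed

text \<open>The relation \<open>k\<^sup>2 - 2 H k + \<lambda> K = 0\<close> turns the factor \<open>2 H\<close> of \<open>second_form_scaled\<close>,
  which may vanish, into \<open>k\<^sup>2 + \<lambda> K\<close>.\<close>

lemma k_rel_sq_second_form:
  assumes "q \<in> U"
  shows "(kr i q)\<^sup>2 * second_form x \<Omega> q $ a $ b
    = lam q * (kr i q * (mu_rel \<Omega> q ** I_rel \<Omega> q ** transpose (mu_rel \<Omega> q)) $ a $ b)
      + Kr q * (kr i q * first_form x q $ a $ b - lam q * second_form x \<Omega> q $ a $ b)"
proof -
  obtain j :: 2 where j: "i \<noteq> j" by (cases "i = 1") (use that[of 1] that[of 2] in auto)
  have "(kr i q)\<^sup>2 = 2 * Hr q * kr i q - lam q * Kr q"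
    unfolding k_rel_mult[OF assms j, symmetric] k_rel_sum[OF j, of q, symmetric]
    by (simp add: power2_eq_square algebra_simps)
  then have "(kr i q)\<^sup>2 * second_form x \<Omega> q $ a $ b
      = kr i q * (2 * Hr q * second_form x \<Omega> q $ a $ b) - lam q * Kr q * second_form x \<Omega> q $ a $ b"
    by (simp only: left_diff_distrib) (simp add: mult_ac)
  also have "2 * Hr q * second_form x \<Omega> q $ a $ b
      = lam q * (mu_rel \<Omega> q ** I_rel \<Omega> q ** transpose (mu_rel \<Omega> q)) $ a $ b + Kr q * first_form x q $ a $ b"
    using arg_cong[OF second_form_scaled[OF assms], of "\<lambda>A. A $ a $ b"] by simp
  finally show ?thesis by (simp add: algebra_simps)
qed

end

section \<open>Equivalence of the four conditions\<close>

theorem theorem4p1: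
  fixes U W :: "(real^2) set" and x :: "real^2 \<Rightarrow> real^3" and \<Omega> :: "real^2 \<Rightarrow> real^2^3"
    and p :: "real^2" and i j :: 2
  assumes "open U"
    and "wavefront U x"
    and "proper_frontal U x"
    and "\<forall>q\<in>singular_set U x. rank (D x q) = 1"
    and "tangent_moving_basis U x \<Omega>"
    and "p \<in> singular_set U x"
    and "compact W" and "W \<subseteq> U" and "p \<in> interior W"
    and "W \<subseteq> closure (W - singular_set U x)"
    and "i \<noteq> j"
    and "\<forall>q\<in>W. k_rel x \<Omega> i q \<noteq> 0"
  defines "stmt1 \<equiv> bounded (gauss_curv x \<Omega> ` (W - singular_set U x))"
    and "stmt2 \<equiv> \<exists>C>0. \<forall>q\<in>W. \<bar>K_rel \<Omega> q\<bar> \<le> C * \<bar>lambda_rel x \<Omega> q\<bar>"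
    and "stmt3 \<equiv> \<exists>C>0. \<forall>q\<in>W. \<bar>princ_curv_ext U x \<Omega> i j q\<bar> \<le> C * \<bar>lambda_rel x \<Omega> q\<bar>"
    and "stmt4 \<equiv> \<exists>C>0. \<forall>q\<in>W. \<bar>e_coeff x \<Omega> q\<bar> \<le> C * \<bar>lambda_rel x \<Omega> q\<bar> \<and>
                              \<bar>f_coeff x \<Omega> q\<bar> \<le> C * \<bar>lambda_rel x \<Omega> q\<bar> \<and>
                              \<bar>g_coeff x \<Omega> q\<bar> \<le> C * \<bar>lambda_rel x \<Omega> q\<bar>"
  shows "(stmt1 \<longleftrightarrow> stmt2) \<and> (stmt2 \<longleftrightarrow> stmt3) \<and> (stmt3 \<longleftrightarrow> stmt4)"
proof -
  interpret tangent_basis U x \<Omega>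
    using assms(1,2,5) by unfold_locales (auto simp: wavefront_def)
  let ?R = "W - singular_set U x"
  let ?S = "second_form x \<Omega>"
  have WU: "q \<in> U" if "q \<in> W" for q using that \<open>W \<subseteq> U\<close> by auto
  have regular: "q \<in> ?R \<longleftrightarrow> q \<in> W \<and> lam q \<noteq> 0" for q
    using singular_iff WU by blast
  have cont: "continuous_on W f" if "continuous_on U f" for f :: "real^2 \<Rightarrow> real"
    using that \<open>W \<subseteq> U\<close> continuous_on_subset by blast
  note bound = compact_continuous_abs_bound[OF \<open>compact W\<close> cont]
  note lower = compact_continuous_abs_lower_bound[OF \<open>compact W\<close> cont]
  have k_nz: "kr i q \<noteq> 0" if "q \<in> W" for q using assms(12) that by auto
  obtain c where c: "c > 0" "\<And>q. q \<in> W \<Longrightarrow> c \<le> \<bar>kr i q\<bar>"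
    using lower[OF continuous_on_k_rel k_nz] by blast
  obtain B where B: "B > 0" "\<And>q. q \<in> W \<Longrightarrow> \<bar>kr i q\<bar> \<le> B"
    using bound[OF continuous_on_k_rel] by blast
  obtain d where d: "d > 0" "\<And>q. q \<in> W \<Longrightarrow> d \<le> \<bar>det (I_rel \<Omega> q)\<bar>"
    using lower[OF continuous_on_det_2[OF continuous_on_I_rel]] I_rel_pos WU by (metis less_irrefl)
  \<comment> \<open>Regular points are dense in \<open>W\<close>, so a bound proved there persists;
    at singular points it says that \<open>Kr\<close> vanishes.\<close>
  have dense: "\<exists>C>0. \<forall>q\<in>W. \<bar>Kr q\<bar> \<le> C * \<bar>lam q\<bar>"
    if "\<And>q. q \<in> ?R \<Longrightarrow> \<bar>Kr q\<bar> \<le> C * \<bar>lam q\<bar>" "C > 0" for C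
    using abs_bound_closure[OF cont[OF continuous_on_K_rel] cont[OF continuous_on_lambda_rel]
        compact_imp_closed[OF \<open>compact W\<close>] Diff_subset assms(10) that(1)] that(2) by blast

  have 12: "stmt1 \<longleftrightarrow> stmt2"
  proof
    assume stmt1
    then obtain C where C: "C > 0" "\<And>q. q \<in> ?R \<Longrightarrow> \<bar>gauss_curv x \<Omega> q\<bar> \<le> C"
      unfolding stmt1_def bounded_pos by auto
    have "\<bar>Kr q\<bar> \<le> C * \<bar>lam q\<bar>" if "q \<in> ?R" for q
    proof -
      have q: "q \<in> U" "lam q \<noteq> 0" using that regular WU by auto
      show ?thesis
        using C(2)[OF that] q(2) by (simp add: gauss_curv_eq[OF q] pos_divide_le_eq)
    qed
    then show stmt2 unfolding stmt2_def by (rule dense) (use C in auto)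
  next
    assume stmt2
    then obtain C where C: "C > 0" "\<And>q. q \<in> W \<Longrightarrow> \<bar>Kr q\<bar> \<le> C * \<bar>lam q\<bar>"
      unfolding stmt2_def by auto
    have "\<bar>gauss_curv x \<Omega> q\<bar> \<le> C" if "q \<in> ?R" for q
    proof -
      have q: "q \<in> W" "q \<in> U" "lam q \<noteq> 0" using that regular WU by auto
      show ?thesis
        using C(2)[OF q(1)] q(3) by (simp add: gauss_curv_eq[OF q(2,3)] pos_divide_le_eq)
    qed
    then show stmt1 unfolding stmt1_def bounded_iff by auto
  qed

  \<comment> \<open>The extended curvature and \<open>Kr\<close> differ by the factor
    \<open>kr i\<close>, whose absolute value lies between \<open>c\<close> and \<open>B\<close> on
    \<open>W\<close>.\<close>
  have ext: "\<bar>Kr q\<bar> = \<bar>princ_curv_ext U x \<Omega> i j q\<bar> * \<bar>kr i q\<bar>" if "q \<in> W" for q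
    using k_nz[OF that] by (simp add: princ_curv_ext_eq[OF WU[OF that] \<open>i \<noteq> j\<close>])
  have 23: "stmt2 \<longleftrightarrow> stmt3"
  proof
    assume stmt2
    then obtain C where C: "C > 0" "\<And>q. q \<in> W \<Longrightarrow> \<bar>Kr q\<bar> \<le> C * \<bar>lam q\<bar>"
      unfolding stmt2_def by auto
    have "\<bar>princ_curv_ext U x \<Omega> i j q\<bar> \<le> C / c * \<bar>lam q\<bar>" if "q \<in> W" for q
    proof -
      have "\<bar>princ_curv_ext U x \<Omega> i j q\<bar> * c \<le> C * \<bar>lam q\<bar>"
        using ext[OF that] C(2)[OF that] mult_left_mono[OF c(2)[OF that]] by (smt (verit) abs_ge_zero)
      then show ?thesis using c(1) by (simp add: field_simps)
    qed
    then show stmt3 unfolding stmt3_def using C(1) c(1) by (intro exI[of _ "C / c"]) auto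
  next
    assume stmt3
    then obtain C where C: "C > 0"
      "\<And>q. q \<in> W \<Longrightarrow> \<bar>princ_curv_ext U x \<Omega> i j q\<bar> \<le> C * \<bar>lam q\<bar>"
      unfolding stmt3_def by auto
    have "\<bar>Kr q\<bar> \<le> C * B * \<bar>lam q\<bar>" if "q \<in> W" for q
    proof -
      have "\<bar>Kr q\<bar> \<le> (C * \<bar>lam q\<bar>) * B"
        unfolding ext[OF that] using C(1) by (intro mult_mono C(2) B(2) that) auto
      then show ?thesis by (simp add: mult_ac)
    qed
    then show stmt2 unfolding stmt2_def using C(1) B(1) by (intro exI[of _ "C * B"]) auto
  qed

  have 24: "stmt4" if "stmt2"
  proof -
    obtain C where C: "C > 0" "\<And>q. q \<in> W \<Longrightarrow> \<bar>Kr q\<bar> \<le> C * \<bar>lam q\<bar>"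
      using \<open>stmt2\<close> unfolding stmt2_def by auto
    have "\<exists>C'>0. \<forall>q\<in>W. \<bar>?S q $ a $ b\<bar> \<le> C' * \<bar>lam q\<bar>" for a b
    proof -
      \<comment> \<open>\<open>P\<close> and \<open>Q\<close> are the continuous coefficients in
        \<open>(kr i q)\<^sup>2 * S = lam q * P q + Kr q * Q q\<close>, hence bounded on
        \<open>W\<close>.\<close>
      define P where "P q = kr i q * (mu_rel \<Omega> q ** I_rel \<Omega> q ** transpose (mu_rel \<Omega> q)) $ a $ b" for q
      define Q where "Q q = kr i q * first_form x q $ a $ b - lam q * ?S q $ a $ b" for q
      have "continuous_on U P"
        unfolding P_def by (intro continuous_intros continuous_on_matrix_mult continuous_on_transpose
            continuous_on_k_rel continuous_on_mu_rel continuous_on_I_rel)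
      then obtain p0 where p0: "p0 > 0" "\<And>q. q \<in> W \<Longrightarrow> \<bar>P q\<bar> \<le> p0" using bound by blast
      have "continuous_on U Q"
        unfolding Q_def by (intro continuous_intros continuous_on_k_rel continuous_on_first_form
            continuous_on_second_form continuous_on_lambda_rel)
      then obtain q0 where q0: "q0 > 0" "\<And>q. q \<in> W \<Longrightarrow> \<bar>Q q\<bar> \<le> q0" using bound by blast
      \<comment> \<open>The right side of that identity is at most \<open>(p0 + C * q0)\<close>
        times the absolute value of \<open>lam q\<close>, and \<open>c\<^sup>2\<close> bounds the
        factor on the left from below.\<close>
      have "\<bar>?S q $ a $ b\<bar> \<le> (p0 + C * q0) / c\<^sup>2 * \<bar>lam q\<bar>" if "q \<in> W" for q
      proof -
        have "c\<^sup>2 * \<bar>?S q $ a $ b\<bar> \<le> (kr i q)\<^sup>2 * \<bar>?S q $ a $ b\<bar>"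
          using c(1) c(2)[OF that] by (intro mult_right_mono) (auto simp flip: abs_le_square_iff)
        also have "\<dots> = \<bar>lam q * P q + Kr q * Q q\<bar>"
          unfolding P_def Q_def k_rel_sq_second_form[OF WU[OF that], symmetric] by (simp add: abs_mult)
        also have "\<dots> \<le> \<bar>lam q\<bar> * \<bar>P q\<bar> + \<bar>Kr q\<bar> * \<bar>Q q\<bar>"
          by (metis abs_mult abs_triangle_ineq)
        also have "\<dots> \<le> \<bar>lam q\<bar> * p0 + (C * \<bar>lam q\<bar>) * q0"
          using C(1) by (intro add_mono mult_mono p0(2) q0(2) C(2) that) auto
        finally show ?thesis using c(1) by (simp add: field_simps)
      qed
      moreover have "(p0 + C * q0) / c\<^sup>2 > 0" using p0(1) q0(1) C(1) c(1) by (simp add: add_pos_pos)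
      ultimately show ?thesis by blast
    qed
    then obtain C' where C': "\<And>a b. C' a b > 0" "\<And>a b q. q \<in> W \<Longrightarrow> \<bar>?S q $ a $ b\<bar> \<le> C' a b * \<bar>lam q\<bar>"
      by metis
    define C1 where "C1 = Max {C' 1 1, C' 1 2, C' 2 2}"
    have C1: "C' 1 1 \<le> C1" "C' 1 2 \<le> C1" "C' 2 2 \<le> C1" by (simp_all add: C1_def)
    have "\<bar>?S q $ a $ b\<bar> \<le> C1 * \<bar>lam q\<bar>" if "q \<in> W" "C' a b \<le> C1" for q a b
      using C'(2)[OF that(1), of a b] mult_right_mono[OF that(2), of "\<bar>lam q\<bar>"] by simp
    moreover have "C1 > 0" using C1(1) C'(1)[of 1 1] by simp
    ultimately show ?thesis unfolding stmt4_def using C1 by blast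
  qed

  have 42: "stmt2" if "stmt4"
  proof -
    obtain C where C: "C > 0" "\<And>q. q \<in> W \<Longrightarrow> \<bar>?S q $ 1 $ 1\<bar> \<le> C * \<bar>lam q\<bar>"
      "\<And>q. q \<in> W \<Longrightarrow> \<bar>?S q $ 1 $ 2\<bar> \<le> C * \<bar>lam q\<bar>" "\<And>q. q \<in> W \<Longrightarrow> \<bar>?S q $ 2 $ 2\<bar> \<le> C * \<bar>lam q\<bar>"
      using \<open>stmt4\<close> unfolding stmt4_def by blast
    \<comment> \<open>The determinant of the second form,
      \<open>lam q * Kr q * det (I_rel \<Omega> q)\<close>, is at most
      \<open>2 * C\<^sup>2 * (lam q)\<^sup>2\<close> in absolute value. Cancelling one factor of
      \<open>lam q\<close>, nonzero at a regular point, and dividing by \<open>d\<close> leaves this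
      constant.\<close>
    have "\<bar>Kr q\<bar> \<le> 2 * C\<^sup>2 / d * \<bar>lam q\<bar>" if "q \<in> ?R" for q
    proof -
      have q: "q \<in> W" "q \<in> U" "lam q \<noteq> 0" using that regular WU by auto
      have "\<bar>lam q\<bar> * (d * \<bar>Kr q\<bar>) \<le> \<bar>lam q * Kr q * det (I_rel \<Omega> q)\<bar>"
      proof -
        have "\<bar>lam q\<bar> * (d * \<bar>Kr q\<bar>) = \<bar>lam q * Kr q\<bar> * d"
          by (simp add: abs_mult)
        also have "\<dots> \<le> \<bar>lam q * Kr q\<bar> * \<bar>det (I_rel \<Omega> q)\<bar>"
          by (intro mult_left_mono d(2) q(1)) simp
        finally show ?thesis by (simp only: abs_mult)
      qed
      also have "\<dots> \<le> \<bar>?S q $ 1 $ 1\<bar> * \<bar>?S q $ 2 $ 2\<bar> + \<bar>?S q $ 1 $ 2\<bar> * \<bar>?S q $ 1 $ 2\<bar>"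
        unfolding det_second_form[OF q(2), symmetric]
        using abs_triangle_ineq4[of "?S q $ 1 $ 1 * ?S q $ 2 $ 2" "?S q $ 1 $ 2 * ?S q $ 1 $ 2"]
        by (simp only: abs_mult power2_eq_square)
      also have "\<dots> \<le> (C * \<bar>lam q\<bar>) * (C * \<bar>lam q\<bar>) + (C * \<bar>lam q\<bar>) * (C * \<bar>lam q\<bar>)"
        using C(1) by (intro add_mono mult_mono C(2-4) q(1)) auto
      also have "\<dots> = \<bar>lam q\<bar> * (2 * C\<^sup>2 * \<bar>lam q\<bar>)" by (simp add: power2_eq_square)
      finally have "d * \<bar>Kr q\<bar> \<le> 2 * C\<^sup>2 * \<bar>lam q\<bar>"
        by (rule mult_left_le_imp_le) (use q(3) in simp)
      then show ?thesis using d(1) by (simp add: field_simps)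
    qed
    then show ?thesis unfolding stmt2_def by (rule dense) (use C d in auto)
  qed
  show ?thesis using 12 23 24 42 by blast
qed

end
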